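(* (i) If $G$ is a cubic graph with a special $1$-factor $F$, then $X=G/F$ admits a $2$-factorization into a blue and a red $2$-factor in which the traversing transitions are exactly the color-switching ones. (ii) Conversely, let $X$ be a quartic multigraph with a given $2$-factorization into a blue $2$-factor $B$ and a red $2$-factor $R$. Let $G$ be the cubic multigraph obtained by replacing each vertex $x$ of $X$ by two vertices $x_B,x_R$ joined by a new edge $e_x$, attaching the two blue edge-ends at $x$ to $x_B$ and the two red edge-ends at $x$ to $x_R$. Then $F=\{e_x\}$ is a special $1$-factor of $G$, $G/F=X$, and this $G$ is the unique special cubic graph determined in this way (by color-preserving splitting of the vertices and insertion of a special $1$-factor) by $X$ with its $2$-factorization.
   Context: For a cubic graph $G$ with $1$-factor $F$ and $Y=G-F$, $G/F$ is obtained by contracting each $e=uv\in F$ to a vertex $x_e$; its edges are those of $Y$ and the four edge-ends at $x_e$ correspond to those of $Y$ at $u$ and $v$. A transition at $x_e$ (an unordered pair of distinct edge-ends) is non-traversing if both come from the same end of $e$, traversing otherwise; it is color-switching if the two edge-ends belong to edges of different colors. $F$ is special if the graph $Y(G,F)$ (vertices: cycles of $Y$; adjacency: joined by an edge of $F$; a loop if an edge of $F$ is a chord of a cycle) is bipartite. A $2$-factorization of a quartic multigraph is a partition of its edges into two spanning $2$-regular subgraphs. *)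

theory Defs
  imports Main
begin

text \<open>
  Multigraphs, with loops and parallel edges allowed. Edge-ends are objects of their own: every edge
  has exactly two of them, and the end \<open>d\<close> of the edge \<open>edge_of G d\<close> is attached to the vertex
  \<open>vert_of G d\<close>. A loop contributes two edge-ends, hence 2 to the degree of its vertex.
\<close>

record ('v, 'e, 'd) mgraph =
  verts :: "'v set"
  edges :: "'e set"
  ends :: "'d set"
  vert_of :: "'d \<Rightarrow> 'v"
  edge_of :: "'d \<Rightarrow> 'e"

definition multigraph :: "('v, 'e, 'd) mgraph \<Rightarrow> bool" where
  "multigraph G \<longleftrightarrow> finite (verts G) \<and> finite (edges G) \<and>
     vert_of G ` ends G \<subseteq> verts G \<and> edge_of G ` ends G \<subseteq> edges G \<and>
     (\<forall>e\<in>edges G. card {d \<in> ends G. edge_of G d = e} = 2)"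

definition degree :: "('v, 'e, 'd) mgraph \<Rightarrow> 'v \<Rightarrow> nat" where
  "degree G v = card {d \<in> ends G. vert_of G d = v}"

definition regular :: "nat \<Rightarrow> ('v, 'e, 'd) mgraph \<Rightarrow> bool" where
  "regular k G \<longleftrightarrow> (\<forall>v\<in>verts G. degree G v = k)"

definition cubic :: "('v, 'e, 'd) mgraph \<Rightarrow> bool" where
  "cubic G \<longleftrightarrow> multigraph G \<and> regular 3 G"

definition quartic :: "('v, 'e, 'd) mgraph \<Rightarrow> bool" where
  "quartic G \<longleftrightarrow> multigraph G \<and> regular 4 G"

definition mgraph_iso ::
  "('v, 'e, 'd) mgraph \<Rightarrow> ('w, 'f, 'c) mgraph \<Rightarrow> ('v \<Rightarrow> 'w) \<Rightarrow> ('e \<Rightarrow> 'f) \<Rightarrow> ('d \<Rightarrow> 'c) \<Rightarrow> bool" where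
  "mgraph_iso G H \<phi> \<psi> \<eta> \<longleftrightarrow>
     bij_betw \<phi> (verts G) (verts H) \<and> bij_betw \<psi> (edges G) (edges H) \<and>
     bij_betw \<eta> (ends G) (ends H) \<and>
     (\<forall>d\<in>ends G. vert_of H (\<eta> d) = \<phi> (vert_of G d) \<and> edge_of H (\<eta> d) = \<psi> (edge_of G d))"

definition restrict_to :: "('v, 'e, 'd) mgraph \<Rightarrow> 'v set \<Rightarrow> 'e set \<Rightarrow> ('v, 'e, 'd) mgraph" where
  "restrict_to G W S =
     \<lparr>verts = W, edges = S, ends = {d \<in> ends G. edge_of G d \<in> S},
      vert_of = vert_of G, edge_of = edge_of G\<rparr>"

definition subgraph :: "('v, 'e, 'd) mgraph \<Rightarrow> ('v, 'e, 'd) mgraph \<Rightarrow> bool" where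
  "subgraph H G \<longleftrightarrow> multigraph H \<and> verts H \<subseteq> verts G \<and> edges H \<subseteq> edges G \<and>
     H = restrict_to G (verts H) (edges H)"

abbreviation spanning :: "('v, 'e, 'd) mgraph \<Rightarrow> 'e set \<Rightarrow> ('v, 'e, 'd) mgraph" where
  "spanning G S \<equiv> restrict_to G (verts G) S"

definition adjacent :: "('v, 'e, 'd) mgraph \<Rightarrow> 'v \<Rightarrow> 'v \<Rightarrow> bool" where
  "adjacent G u v \<longleftrightarrow> (\<exists>d\<in>ends G. \<exists>d'\<in>ends G. d \<noteq> d' \<and> edge_of G d = edge_of G d' \<and>
     vert_of G d = u \<and> vert_of G d' = v)"

definition connected :: "('v, 'e, 'd) mgraph \<Rightarrow> bool" where
  "connected G \<longleftrightarrow> verts G \<noteq> {} \<and> (\<forall>u\<in>verts G. \<forall>v\<in>verts G. (adjacent G)\<^sup>*\<^sup>* u v)"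

text \<open>Cycles of length 1 (a loop) and 2 (two parallel edges) are included.\<close>

definition cycles :: "('v, 'e, 'd) mgraph \<Rightarrow> ('v, 'e, 'd) mgraph set" where
  "cycles G = {C. subgraph C G \<and> connected C \<and> regular 2 C}"

definition one_factor :: "('v, 'e, 'd) mgraph \<Rightarrow> 'e set \<Rightarrow> bool" where
  "one_factor G F \<longleftrightarrow> F \<subseteq> edges G \<and> regular 1 (spanning G F)"

definition two_factor :: "('v, 'e, 'd) mgraph \<Rightarrow> 'e set \<Rightarrow> bool" where
  "two_factor G S \<longleftrightarrow> S \<subseteq> edges G \<and> regular 2 (spanning G S)"

definition two_factorization :: "('v, 'e, 'd) mgraph \<Rightarrow> 'e set \<Rightarrow> 'e set \<Rightarrow> bool" where
  "two_factorization X B R \<longleftrightarrow>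
     two_factor X B \<and> two_factor X R \<and> B \<union> R = edges X \<and> B \<inter> R = {}"

text \<open>
  The graph \<open>Y(G,F)\<close> as a vertex set with an adjacency relation; a chord in \<open>F\<close> of a cycle \<open>C\<close>
  of \<open>G - F\<close> yields the loop \<open>(C, C)\<close>.
\<close>

definition cycle_graph ::
  "('v, 'e, 'd) mgraph \<Rightarrow> 'e set \<Rightarrow> ('v, 'e, 'd) mgraph set \<times> ('v, 'e, 'd) mgraph rel" where
  "cycle_graph G F =
     (let Y = spanning G (edges G - F) in
       (cycles Y,
        {(C, C'). C \<in> cycles Y \<and> C' \<in> cycles Y \<and>
           (\<exists>e\<in>F. \<exists>d\<in>ends G. \<exists>d'\<in>ends G. d \<noteq> d' \<and> edge_of G d = e \<and> edge_of G d' = e \<and>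
              vert_of G d \<in> verts C \<and> vert_of G d' \<in> verts C')}))"

definition bipartite :: "'a set \<times> 'a rel \<Rightarrow> bool" where
  "bipartite H \<longleftrightarrow> (\<exists>P Q. P \<union> Q = fst H \<and> P \<inter> Q = {} \<and>
     (\<forall>(x, y)\<in>snd H. x \<in> P \<and> y \<in> Q \<or> x \<in> Q \<and> y \<in> P))"

definition special_one_factor :: "('v, 'e, 'd) mgraph \<Rightarrow> 'e set \<Rightarrow> bool" where
  "special_one_factor G F \<longleftrightarrow> one_factor G F \<and> bipartite (cycle_graph G F)"

text \<open>
  The contraction \<open>G/F\<close> for a 1-factor \<open>F\<close>: the vertex \<open>x\<^sub>e\<close> is represented by the edge \<open>e\<close> itself.
  As \<open>F\<close> covers every vertex exactly once, no other vertices remain and the description below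
  is unique.
\<close>

definition contract :: "('v, 'e, 'd) mgraph \<Rightarrow> 'e set \<Rightarrow> ('e, 'e, 'd) mgraph" where
  "contract G F =
     \<lparr>verts = F, edges = edges G - F, ends = {d \<in> ends G. edge_of G d \<in> edges G - F},
      vert_of = (\<lambda>d. THE e. e \<in> F \<and>
        (\<exists>d'\<in>ends G. edge_of G d' = e \<and> vert_of G d' = vert_of G d)),
      edge_of = edge_of G\<rparr>"

definition transition_at :: "('v, 'e, 'd) mgraph \<Rightarrow> 'v \<Rightarrow> 'd set \<Rightarrow> bool" where
  "transition_at X x t \<longleftrightarrow> (\<exists>d\<in>ends X. \<exists>d'\<in>ends X. d \<noteq> d' \<and> t = {d, d'} \<and>
     vert_of X d = x \<and> vert_of X d' = x)"

text \<open>For a transition \<open>t\<close> at the vertex \<open>x\<^sub>e\<close> of a contraction of \<open>G\<close>.\<close>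

definition non_traversing :: "('v, 'e, 'd) mgraph \<Rightarrow> 'e \<Rightarrow> 'd set \<Rightarrow> bool" where
  "non_traversing G e t \<longleftrightarrow>
     (\<exists>d\<^sub>0\<in>ends G. edge_of G d\<^sub>0 = e \<and> (\<forall>d\<in>t. vert_of G d = vert_of G d\<^sub>0))"

definition traversing :: "('v, 'e, 'd) mgraph \<Rightarrow> 'e \<Rightarrow> 'd set \<Rightarrow> bool" where
  "traversing G e t \<longleftrightarrow> \<not> non_traversing G e t"

definition color_switching ::
  "('v, 'e, 'd) mgraph \<Rightarrow> 'e set \<Rightarrow> 'e set \<Rightarrow> 'd set \<Rightarrow> bool" where
  "color_switching X B R t \<longleftrightarrow> (\<exists>d\<in>t. \<exists>d'\<in>t. edge_of X d \<in> B \<and> edge_of X d' \<in> R)"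

datatype color = Blue | Red

text \<open>
  The vertices \<open>x\<^sub>B\<close>, \<open>x\<^sub>R\<close> are \<open>(x, Blue)\<close>, \<open>(x, Red)\<close>; the new edge \<open>e\<^sub>x\<close> is \<open>Inr x\<close>, and
  its end at \<open>(x, c)\<close> is \<open>Inr (x, c)\<close>. Edges and edge-ends of \<open>X\<close> are embedded by \<open>Inl\<close>.
\<close>

definition color_split ::
  "('v, 'e, 'd) mgraph \<Rightarrow> 'e set \<Rightarrow> ('v \<times> color, 'e + 'v, 'd + 'v \<times> color) mgraph" where
  "color_split X B =
     \<lparr>verts = verts X \<times> UNIV,
      edges = Inl ` edges X \<union> Inr ` verts X,
      ends = Inl ` ends X \<union> Inr ` (verts X \<times> UNIV),
      vert_of = case_sum (\<lambda>d. (vert_of X d, if edge_of X d \<in> B then Blue else Red)) (\<lambda>p. p),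
      edge_of = case_sum (\<lambda>d. Inl (edge_of X d)) (\<lambda>p. Inr (fst p))\<rparr>"

text \<open>
  \<open>G\<close> arises from \<open>X\<close> by splitting every vertex into two adjacent ones, joined by an inserted edge of
  the special 1-factor \<open>F\<close>, in such a way that edge-ends attached to the same vertex of \<open>G\<close> have the
  same color. The maps \<open>\<phi>\<close>, \<open>\<psi>\<close>, \<open>\<eta>\<close> identify \<open>X\<close> with \<open>G/F\<close>; in particular \<open>\<phi> x\<close> is the
  edge of \<open>F\<close> inserted at \<open>x\<close>.
\<close>

definition special_color_splitting ::
  "('v, 'e, 'd) mgraph \<Rightarrow> 'e set \<Rightarrow> 'e set \<Rightarrow> ('w, 'f, 'c) mgraph \<Rightarrow> 'f set \<Rightarrow>
   ('v \<Rightarrow> 'f) \<Rightarrow> ('e \<Rightarrow> 'f) \<Rightarrow> ('d \<Rightarrow> 'c) \<Rightarrow> bool" where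
  "special_color_splitting X B R G F \<phi> \<psi> \<eta> \<longleftrightarrow>
     cubic G \<and> special_one_factor G F \<and> mgraph_iso X (contract G F) \<phi> \<psi> \<eta> \<and>
     (\<forall>d\<in>ends X. \<forall>d'\<in>ends X. vert_of G (\<eta> d) = vert_of G (\<eta> d') \<longrightarrow>
        edge_of X d \<in> B \<and> edge_of X d' \<in> B \<or> edge_of X d \<in> R \<and> edge_of X d' \<in> R)"

end

theory Submission
  imports Defs
begin

text \<open>
  A 1-factor \<open>F\<close> is special iff the vertices can be 2-colored so that the edges of \<open>G - F\<close> are
  monochromatic and those of \<open>F\<close> are not: color every vertex by the class of its cycle.
  Giving the edges of \<open>G - F\<close> the color of their ends yields (i). In (ii) the coloring of the split
  graph is the tautological one. For uniqueness, only two vertices are available for the edge-ends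
  at \<open>x\<close>, each of them receives only one color, and both colors occur at \<open>x\<close>; hence all blue
  edge-ends go to one of them and all red ones to the other.
\<close>

section \<open>Components of 2-regular graphs\<close>

text \<open>One reachable end suffices to select an edge, since \<open>reachable_edge\<close> makes
  its other end reachable too. The form \<open>restrict_to\<close> makes the equation demanded by
  \<open>subgraph\<close> immediate.\<close>

definition component :: "('v, 'e, 'd) mgraph \<Rightarrow> 'v \<Rightarrow> ('v, 'e, 'd) mgraph" where
  "component Y v = restrict_to Y {w \<in> verts Y. (adjacent Y)\<^sup>*\<^sup>* v w}
     {e \<in> edges Y. \<exists>d\<in>ends Y. edge_of Y d = e \<and> (adjacent Y)\<^sup>*\<^sup>* v (vert_of Y d)}"

lemma restrict_to_simps [simp]:
  "verts (restrict_to G W S) = W"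
  "edges (restrict_to G W S) = S"
  "ends (restrict_to G W S) = {d \<in> ends G. edge_of G d \<in> S}"
  "vert_of (restrict_to G W S) = vert_of G"
  "edge_of (restrict_to G W S) = edge_of G"
  by (simp_all add: restrict_to_def)

lemma multigraph_spanning: "multigraph G \<Longrightarrow> S \<subseteq> edges G \<Longrightarrow> multigraph (spanning G S)"
  by (auto simp: multigraph_def finite_subset conj_commute cong: conj_cong)

lemma adjacent_sym: "adjacent G u v \<Longrightarrow> adjacent G v u"
  unfolding adjacent_def by metis

lemma reachable_sym: "(adjacent G)\<^sup>*\<^sup>* u v \<Longrightarrow> (adjacent G)\<^sup>*\<^sup>* v u"
  by (metis adjacent_sym sympD sympI symp_rtranclp)

lemma reachable_edge:
  assumes "d \<in> ends G" "d' \<in> ends G" "edge_of G d = edge_of G d'"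
  shows "(adjacent G)\<^sup>*\<^sup>* (vert_of G d) (vert_of G d')"
proof (cases "d = d'")
  case False
  then have "adjacent G (vert_of G d) (vert_of G d')"
    using assms unfolding adjacent_def by blast
  then show ?thesis by blast
qed simp

text \<open>A component depends on its base vertex only through reachability. The result is an
  equality of records, so the component can serve as a label that is constant along edges.\<close>

lemma component_eq:
  assumes "(adjacent Y)\<^sup>*\<^sup>* u v"
  shows "component Y u = component Y v"
proof -
  have "(adjacent Y)\<^sup>*\<^sup>* u w \<longleftrightarrow> (adjacent Y)\<^sup>*\<^sup>* v w" for w
    using assms reachable_sym[OF assms] by (meson rtranclp_trans)
  then show ?thesis by (simp add: component_def)
qed

lemma in_component: "v \<in> verts Y \<Longrightarrow> v \<in> verts (component Y v)"
  by (simp add: component_def)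

text \<open>Supplies a definite cycle through each vertex. All edge-ends at a reachable vertex
  belong to the component, so its degrees are those in \<open>Y\<close>.\<close>

lemma component_in_cycles:
  assumes Y: "multigraph Y" "regular 2 Y" and v: "v \<in> verts Y"
  shows "component Y v \<in> cycles Y"
proof -
  let ?C = "component Y v" and ?r = "(adjacent Y)\<^sup>*\<^sup>* v"
  \<comment> \<open>The definition selects ends through their edges; this description through their
    vertices is what the degree count needs.\<close>
  have endsC: "ends ?C = {d \<in> ends Y. ?r (vert_of Y d)}"
  proof -
    have "?r (vert_of Y d)"
      if "d \<in> ends Y" "d' \<in> ends Y" "edge_of Y d' = edge_of Y d" "?r (vert_of Y d')" for d d'
      using reachable_edge[of d' Y d] that by (meson rtranclp_trans)
    moreover have "edge_of Y d \<in> edges Y" if "d \<in> ends Y" for d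
      using Y that by (auto simp: multigraph_def)
    ultimately show ?thesis by (auto simp: component_def)
  qed
  have simps: "verts ?C = {w \<in> verts Y. ?r w}" "vert_of ?C = vert_of Y" "edge_of ?C = edge_of Y"
    "edges ?C = {e \<in> edges Y. \<exists>d\<in>ends Y. edge_of Y d = e \<and> ?r (vert_of Y d)}"
    by (simp_all add: component_def)
  have "multigraph ?C"
    unfolding multigraph_def
  proof (intro conjI ballI)
    show "finite (verts ?C)" "finite (edges ?C)"
      using Y by (auto simp: simps multigraph_def)
    show "vert_of ?C ` ends ?C \<subseteq> verts ?C"
      using Y by (auto simp: simps endsC multigraph_def)
    show "edge_of ?C ` ends ?C \<subseteq> edges ?C"
      using Y by (auto simp: simps endsC multigraph_def)
    fix e assume e: "e \<in> edges ?C"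
    then have "{d \<in> ends ?C. edge_of ?C d = e} = {d \<in> ends Y. edge_of Y d = e}"
      by (auto simp: component_def)
    then show "card {d \<in> ends ?C. edge_of ?C d = e} = 2"
      using Y e by (auto simp: simps multigraph_def)
  qed
  moreover have "?C = restrict_to Y (verts ?C) (edges ?C)"
    by (simp add: component_def)
  ultimately have "subgraph ?C Y"
    by (auto simp: subgraph_def simps)
  moreover have "regular 2 ?C"
    unfolding regular_def degree_def
  proof
    fix w assume w: "w \<in> verts ?C"
    then have "{d \<in> ends ?C. vert_of ?C d = w} = {d \<in> ends Y. vert_of Y d = w}"
      by (auto simp: simps endsC)
    then show "card {d \<in> ends ?C. vert_of ?C d = w} = 2"
      using Y w by (auto simp: simps regular_def degree_def)
  qed
  moreover have "connected ?C"
  proof -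
    \<comment> \<open>A walk in \<open>Y\<close> from \<open>v\<close> never leaves the component,
      so it can be retraced there. Going back to \<open>v\<close> and out again then connects any
      two vertices.\<close>
    have reach: "(adjacent ?C)\<^sup>*\<^sup>* v w" if "?r w" for w
      using that
    proof (induction rule: rtranclp_induct)
      case (step y z)
      then have "?r z" by (meson rtranclp.rtrancl_into_rtrancl)
      with step have "adjacent ?C y z"
        unfolding adjacent_def endsC simps by blast
      with step show ?case by (meson rtranclp.rtrancl_into_rtrancl)
    qed simp
    have "(adjacent ?C)\<^sup>*\<^sup>* u w" if "u \<in> verts ?C" "w \<in> verts ?C" for u w
      using reachable_sym[OF reach] reach that by (auto simp: simps intro: rtranclp_trans)
    then show ?thesis
      using in_component[OF v] by (auto simp: connected_def)
  qed
  ultimately show ?thesis by (simp add: cycles_def)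
qed

section \<open>Cubic graphs with a 1-factor\<close>

text \<open>Speaking of pairs of edge-ends treats loops uniformly: a loop outside \<open>F\<close>
  satisfies the condition trivially, a loop in \<open>F\<close> violates it.\<close>

definition switching_coloring :: "('v, 'e, 'd) mgraph \<Rightarrow> 'e set \<Rightarrow> ('v \<Rightarrow> bool) \<Rightarrow> bool" where
  "switching_coloring G F c \<longleftrightarrow> (\<forall>d\<in>ends G. \<forall>d'\<in>ends G. edge_of G d' = edge_of G d \<longrightarrow> d \<noteq> d' \<longrightarrow>
     (c (vert_of G d) = c (vert_of G d') \<longleftrightarrow> edge_of G d \<notin> F))"

lemma switching_coloringD:
  assumes "switching_coloring G F c" "d \<in> ends G" "d' \<in> ends G" "edge_of G d' = edge_of G d"
  shows "edge_of G d \<notin> F \<Longrightarrow> c (vert_of G d) = c (vert_of G d')"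
    and "edge_of G d \<in> F \<Longrightarrow> d \<noteq> d' \<Longrightarrow> c (vert_of G d) \<noteq> c (vert_of G d')"
  using assms unfolding switching_coloring_def by metis+

locale cubic_one_factor =
  fixes G :: "('v, 'e, 'd) mgraph" and F :: "'e set"
  assumes cubic: "cubic G" and one_factor: "one_factor G F"
begin

text \<open>Well-defined on the vertices of \<open>G\<close> by \<open>ex1_F_end\<close>.
  Consequently \<open>fedge v\<close> is the vertex of the contraction into which \<open>v\<close>
  is merged.\<close>

definition fend :: "'v \<Rightarrow> 'd" where
  "fend v = (THE d. d \<in> ends G \<and> edge_of G d \<in> F \<and> vert_of G d = v)"

abbreviation fedge :: "'v \<Rightarrow> 'e" where
  "fedge v \<equiv> edge_of G (fend v)"

lemma multigraph: "multigraph G"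
  using cubic by (simp add: cubic_def)

lemma F_subset: "F \<subseteq> edges G"
  using one_factor by (simp add: one_factor_def)

lemma vert_in: "d \<in> ends G \<Longrightarrow> vert_of G d \<in> verts G"
  using multigraph by (auto simp: multigraph_def)

lemma edge_in: "d \<in> ends G \<Longrightarrow> edge_of G d \<in> edges G"
  using multigraph by (auto simp: multigraph_def)

lemma card_F_ends: "v \<in> verts G \<Longrightarrow> card {d \<in> ends G. edge_of G d \<in> F \<and> vert_of G d = v} = 1"
  using one_factor by (simp add: one_factor_def regular_def degree_def conj_assoc)

lemma ex1_F_end:
  assumes "v \<in> verts G"
  shows "\<exists>!d. d \<in> ends G \<and> edge_of G d \<in> F \<and> vert_of G d = v"
proof -
  obtain d where "{d \<in> ends G. edge_of G d \<in> F \<and> vert_of G d = v} = {d}"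
    using card_F_ends[OF assms] by (auto simp: card_1_singleton_iff)
  then have "x \<in> ends G \<and> edge_of G x \<in> F \<and> vert_of G x = v \<longleftrightarrow> x = d" for x
    by (simp add: set_eq_iff)
  then show ?thesis by simp
qed

lemma fend:
  assumes "v \<in> verts G"
  shows "fend v \<in> ends G" "fedge v \<in> F" "vert_of G (fend v) = v"
  using theI'[OF ex1_F_end[OF assms], folded fend_def] by auto

text \<open>With \<open>fend(3)\<close> this makes \<open>fend\<close> and \<open>vert_of G\<close>
  mutually inverse between the vertices and the edge-ends of \<open>F\<close>.\<close>

lemma fend_vert_of: "d \<in> ends G \<Longrightarrow> edge_of G d \<in> F \<Longrightarrow> fend (vert_of G d) = d"
  using fend ex1_F_end vert_in by metis

text \<open>Of the three edge-ends at a vertex exactly one belongs to \<open>F\<close>. All later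
  degree counts for the contraction and the complement of \<open>F\<close> rest on this.\<close>

lemma card_non_F_ends:
  assumes "v \<in> verts G"
  shows "card {d \<in> ends G. edge_of G d \<notin> F \<and> vert_of G d = v} = 2"
proof -
  let ?A = "{d \<in> ends G. edge_of G d \<in> F \<and> vert_of G d = v}"
  let ?D = "{d \<in> ends G. vert_of G d = v}"
  have D: "card ?D = 3"
    using cubic assms by (simp add: cubic_def regular_def degree_def)
  have "card (?D - ?A) = card ?D - card ?A"
    using card_F_ends[OF assms] by (intro card_Diff_subset) (auto intro: card_ge_0_finite)
  moreover have "?D - ?A = {d \<in> ends G. edge_of G d \<notin> F \<and> vert_of G d = v}" by auto
  ultimately show ?thesis using D card_F_ends[OF assms] by simp
qed

text \<open>Two distinct ends of an edge of \<open>F\<close> lie at distinct vertices, because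
  \<open>fend\<close> recovers an end from its vertex. The last clause identifies the vertices
  merged into \<open>e\<close>.\<close>

lemma F_edge_ends:
  assumes "e \<in> F"
  obtains u v where "u \<noteq> v" "u \<in> verts G" "v \<in> verts G"
    "{d \<in> ends G. edge_of G d = e} = {fend u, fend v}"
    "\<forall>w\<in>verts G. fedge w = e \<longleftrightarrow> w = u \<or> w = v"
proof -
  have "card {d \<in> ends G. edge_of G d = e} = 2"
    using assms multigraph F_subset by (auto simp: multigraph_def)
  then obtain a b where ab: "{d \<in> ends G. edge_of G d = e} = {a, b}" "a \<noteq> b"
    by (auto simp: card_2_iff)
  then have a: "a \<in> ends G" "edge_of G a = e" and b: "b \<in> ends G" "edge_of G b = e"
    by blast+
  have fe: "fend (vert_of G a) = a" "fend (vert_of G b) = b"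
    using fend_vert_of a b assms by auto
  show thesis
  proof
    show "vert_of G a \<noteq> vert_of G b" using fe ab(2) by metis
    show "vert_of G a \<in> verts G" "vert_of G b \<in> verts G" using a b vert_in by auto
    show "{d \<in> ends G. edge_of G d = e} = {fend (vert_of G a), fend (vert_of G b)}"
      using ab fe by simp
    show "\<forall>w\<in>verts G. fedge w = e \<longleftrightarrow> w = vert_of G a \<or> w = vert_of G b"
    proof (intro ballI iffI)
      fix w assume w: "w \<in> verts G"
      assume "fedge w = e"
      then have "fend w \<in> {a, b}" using ab(1) fend(1)[OF w] by blast
      then show "w = vert_of G a \<or> w = vert_of G b" using fend(3)[OF w] by auto
    qed (use fe a b in auto)
  qed
qed

section \<open>The contraction of a 1-factor and its degrees\<close>

lemma contract_simps [simp]: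
  "verts (contract G F) = F"
  "edges (contract G F) = edges G - F"
  "ends (contract G F) = {d \<in> ends G. edge_of G d \<notin> F}"
  "edge_of (contract G F) = edge_of G"
  using edge_in by (auto simp: contract_def)

text \<open>Replaces the definite description in \<open>contract\<close> by \<open>fedge\<close>;
  uniqueness comes from \<open>fend_vert_of\<close>.\<close>

lemma vert_of_contract:
  assumes "d \<in> ends G"
  shows "vert_of (contract G F) d = fedge (vert_of G d)"
proof -
  note v = vert_in[OF assms]
  have "(THE e. e \<in> F \<and> (\<exists>d'\<in>ends G. edge_of G d' = e \<and> vert_of G d' = vert_of G d))
        = fedge (vert_of G d)"
  proof (rule the_equality)
    show "fedge (vert_of G d) \<in> F \<and>
        (\<exists>d'\<in>ends G. edge_of G d' = fedge (vert_of G d) \<and> vert_of G d' = vert_of G d)"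
      using fend[OF v] by blast
    show "e = fedge (vert_of G d)"
      if "e \<in> F \<and> (\<exists>d'\<in>ends G. edge_of G d' = e \<and> vert_of G d' = vert_of G d)" for e
      using that by (auto dest: fend_vert_of)
  qed
  then show ?thesis by (simp add: contract_def)
qed

lemma contract_ends_at:
  assumes "\<forall>w\<in>verts G. fedge w = e \<longleftrightarrow> w = u \<or> w = v"
  shows "{d \<in> ends (contract G F). vert_of (contract G F) d = e} =
    {d \<in> ends G. edge_of G d \<notin> F \<and> vert_of G d = u} \<union>
    {d \<in> ends G. edge_of G d \<notin> F \<and> vert_of G d = v}"
proof -
  have "vert_of (contract G F) d = e \<longleftrightarrow> vert_of G d = u \<or> vert_of G d = v"
    if "d \<in> ends G" for d
    using bspec[OF assms vert_in[OF that]] that by (simp add: vert_of_contract)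
  then show ?thesis unfolding contract_simps by blast
qed

text \<open>The four edge-ends at a contracted edge are the two remaining ones at each of its two
  end vertices.\<close>

lemma quartic_contract: "quartic (contract G F)"
proof -
  have "multigraph (contract G F)"
    unfolding multigraph_def
  proof (intro conjI ballI)
    show "finite (verts (contract G F))" "finite (edges (contract G F))"
      using multigraph F_subset by (auto simp: multigraph_def intro: finite_subset)
    show "vert_of (contract G F) ` ends (contract G F) \<subseteq> verts (contract G F)"
      using vert_in fend(2) by (auto simp: vert_of_contract)
    show "edge_of (contract G F) ` ends (contract G F) \<subseteq> edges (contract G F)"
      using edge_in by auto
    fix e assume e: "e \<in> edges (contract G F)"
    then have "{d \<in> ends (contract G F). edge_of (contract G F) d = e} =
        {d \<in> ends G. edge_of G d = e}" by auto
    then show "card {d \<in> ends (contract G F). edge_of (contract G F) d = e} = 2"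
      using e multigraph by (simp add: multigraph_def)
  qed
  moreover have "regular 4 (contract G F)"
    unfolding regular_def
  proof
    fix e assume "e \<in> verts (contract G F)"
    then have "e \<in> F" by simp
    then obtain u v where uv: "u \<noteq> v" "u \<in> verts G" "v \<in> verts G"
      and uv_iff: "\<forall>w\<in>verts G. fedge w = e \<longleftrightarrow> w = u \<or> w = v"
      by (rule F_edge_ends)
    have "card ({d \<in> ends G. edge_of G d \<notin> F \<and> vert_of G d = u} \<union>
        {d \<in> ends G. edge_of G d \<notin> F \<and> vert_of G d = v}) = 2 + 2"
      using uv card_non_F_ends
      by (subst card_Un_disjoint) (auto intro: card_ge_0_finite)
    then show "degree (contract G F) e = 4"
      unfolding degree_def contract_ends_at[OF uv_iff] by simp
  qed
  ultimately show ?thesis by (simp add: quartic_def)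
qed

lemma regular_2_complement: "regular 2 (spanning G (edges G - F))"
  unfolding regular_def degree_def
proof
  fix v assume "v \<in> verts (spanning G (edges G - F))"
  moreover have "{d \<in> ends (spanning G (edges G - F)). vert_of (spanning G (edges G - F)) d = v} =
      {d \<in> ends G. edge_of G d \<notin> F \<and> vert_of G d = v}"
    using edge_in by auto
  ultimately show "card {d \<in> ends (spanning G (edges G - F)).
      vert_of (spanning G (edges G - F)) d = v} = 2"
    using card_non_F_ends by simp
qed

section \<open>Special 1-factors versus switching colorings\<close>

lemma special_imp_coloring:
  assumes "special_one_factor G F"
  shows "\<exists>c. switching_coloring G F c"
proof -
  define Y where "Y = spanning G (edges G - F)"
  let ?c = "component Y"
  have fst: "fst (cycle_graph G F) = cycles Y"
    by (simp add: cycle_graph_def Y_def Let_def)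
  obtain P Q where PQ: "P \<union> Q = cycles Y" "P \<inter> Q = {}" and
    cross: "\<forall>(x, y)\<in>snd (cycle_graph G F). x \<in> P \<and> y \<in> Q \<or> x \<in> Q \<and> y \<in> P"
    using assms unfolding special_one_factor_def bipartite_def fst by (elim conjE exE)
  have comp: "?c v \<in> cycles Y" "v \<in> verts (?c v)" if "v \<in> verts G" for v
    using that multigraph_spanning[OF multigraph, of "edges G - F"] regular_2_complement
    unfolding Y_def by (simp_all add: component_in_cycles in_component)
  \<comment> \<open>An edge outside \<open>F\<close> stays within one component. An edge of
    \<open>F\<close> gives an adjacent pair of cycles, which \<open>cross\<close> puts on opposite
    sides; disjointness of \<open>P\<close> and \<open>Q\<close> makes membership in
    \<open>P\<close> tell the sides apart.\<close>
  have "switching_coloring G F (\<lambda>v. ?c v \<in> P)"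
    unfolding switching_coloring_def
  proof (intro ballI impI)
    fix d d' assume d: "d \<in> ends G" "d' \<in> ends G" "edge_of G d' = edge_of G d" "d \<noteq> d'"
    show "((?c (vert_of G d) \<in> P) = (?c (vert_of G d') \<in> P)) \<longleftrightarrow> edge_of G d \<notin> F"
    proof (cases "edge_of G d \<in> F")
      case False
      then have "(adjacent Y)\<^sup>*\<^sup>* (vert_of G d) (vert_of G d')"
        using d reachable_edge[of d Y d'] edge_in by (auto simp: Y_def)
      then show ?thesis
        using False component_eq by metis
    next
      case True
      then have "(?c (vert_of G d), ?c (vert_of G d')) \<in> snd (cycle_graph G F)"
        using d comp[OF vert_in[OF d(1)]] comp[OF vert_in[OF d(2)]]
        unfolding cycle_graph_def Let_def Y_def[symmetric] by auto
      then show ?thesis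
        using True cross PQ by blast
    qed
  qed
  then show ?thesis by blast
qed

text \<open>The ends of an edge \<open>e\<close> of \<open>F\<close> have opposite colors. Thus the
  edge-ends of one color at the contracted vertex are exactly those at one end of \<open>e\<close>,
  which yields both the degree 2 and the statement on transitions.\<close>

lemma two_factorization_of_coloring:
  assumes c: "switching_coloring G F c"
  shows "\<exists>B R. two_factorization (contract G F) B R \<and>
    (\<forall>e\<in>verts (contract G F). \<forall>t. transition_at (contract G F) e t \<longrightarrow>
      (traversing G e t \<longleftrightarrow> color_switching (contract G F) B R t))"
proof -
  define E where
    "E b = {e \<in> edges G - F. \<exists>d\<in>ends G. edge_of G d = e \<and> c (vert_of G d) = b}" for b
  \<comment> \<open>\<open>E b\<close> asks for some end of color \<open>b\<close>; since edges
    outside \<open>F\<close> are monochromatic, the color can be read off at either end.\<close>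
  have E: "edge_of G d \<in> E b \<longleftrightarrow> c (vert_of G d) = b" if "d \<in> ends G" "edge_of G d \<notin> F" for d b
  proof
    assume "edge_of G d \<in> E b"
    then obtain d' where d': "d' \<in> ends G" "edge_of G d' = edge_of G d" "c (vert_of G d') = b"
      unfolding E_def by blast
    then show "c (vert_of G d) = b"
      using switching_coloringD(1)[OF c that(1) d'(1,2) that(2)] by simp
  next
    assume "c (vert_of G d) = b"
    then show "edge_of G d \<in> E b"
      unfolding E_def using that edge_in by blast
  qed
  have ends_of: "\<exists>u v. u \<noteq> v \<and> u \<in> verts G \<and> v \<in> verts G \<and> c u \<noteq> c v \<and>
      {d \<in> ends G. edge_of G d = e} = {fend u, fend v} \<and>
      (\<forall>w\<in>verts G. fedge w = e \<longleftrightarrow> w = u \<or> w = v)" if e: "e \<in> F" for e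
  proof -
    obtain u v where uv: "u \<noteq> v" "u \<in> verts G" "v \<in> verts G"
      "{d \<in> ends G. edge_of G d = e} = {fend u, fend v}"
      "\<forall>w\<in>verts G. fedge w = e \<longleftrightarrow> w = u \<or> w = v"
      by (rule F_edge_ends[OF e])
    have "fend u \<noteq> fend v" using uv(1) fend(3)[OF uv(2)] fend(3)[OF uv(3)] by auto
    then have "c u \<noteq> c v"
      using switching_coloringD(2)[OF c, of "fend u" "fend v"] fend[OF uv(2)] fend[OF uv(3)]
        bspec[OF uv(5) uv(2)] bspec[OF uv(5) uv(3)]
      by simp
    with uv show ?thesis by (intro exI[of _ u] exI[of _ v] conjI)
  qed
  have two: "two_factor (contract G F) (E b)" for b
    unfolding two_factor_def regular_def
  proof (intro conjI ballI)
    show "E b \<subseteq> edges (contract G F)" by (auto simp: E_def)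
    fix e assume "e \<in> verts (spanning (contract G F) (E b))"
    then obtain u v where uv: "u \<in> verts G" "v \<in> verts G" "c u \<noteq> c v"
      "\<forall>w\<in>verts G. fedge w = e \<longleftrightarrow> w = u \<or> w = v"
      using ends_of[of e] unfolding restrict_to_simps contract_simps by blast
    \<comment> \<open>Stated for an abstract \<open>z\<close>, the end of \<open>e\<close> with
      color \<open>b\<close>, so that it applies to \<open>u\<close> as well as to
      \<open>v\<close>.\<close>
    have deg: "degree (spanning (contract G F) (E b)) e = 2"
      if z: "c z = b" "z \<in> verts G" "\<And>w. w \<in> verts G \<Longrightarrow> c w = b \<Longrightarrow> fedge w = e \<longleftrightarrow> w = z" for z
    proof -
      have "edge_of G d \<in> E b \<and> vert_of (contract G F) d = e \<longleftrightarrow> vert_of G d = z"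
        if "d \<in> ends G" "edge_of G d \<notin> F" for d
        using that(1) E[OF that] z(1) z(3)[OF vert_in[OF that(1)]] by (auto simp: vert_of_contract)
      then have "{d \<in> ends (spanning (contract G F) (E b)). vert_of (spanning (contract G F) (E b)) d = e}
          = {d \<in> ends G. edge_of G d \<notin> F \<and> vert_of G d = z}"
        unfolding restrict_to_simps contract_simps by blast
      then show ?thesis using card_non_F_ends z(2) by (simp add: degree_def)
    qed
    consider "c u = b" | "c v = b" using uv(3) by auto
    then show "degree (spanning (contract G F) (E b)) e = 2"
    proof cases
      case 1
      then show ?thesis using uv(3) bspec[OF uv(4)] by (intro deg[OF _ uv(1)]) metis+
    next
      case 2
      then show ?thesis using uv(3) bspec[OF uv(4)] by (intro deg[OF _ uv(2)]) metis+
    qed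
  qed
  have "E True \<union> E False = edges (contract G F)"
  proof -
    have "\<exists>d\<in>ends G. edge_of G d = e" if "e \<in> edges G" for e
    proof -
      have "card {d \<in> ends G. edge_of G d = e} = 2"
        using that multigraph by (simp add: multigraph_def)
      then have "{d \<in> ends G. edge_of G d = e} \<noteq> {}" by (metis card.empty zero_neq_numeral)
      then show ?thesis by blast
    qed
    then show ?thesis unfolding E_def contract_simps by blast
  qed
  moreover have "E True \<inter> E False = {}"
  proof -
    have False if e: "e \<in> E True" "e \<in> E False" for e
    proof -
      obtain d where "d \<in> ends G" "edge_of G d = e" "c (vert_of G d)" "e \<notin> F"
        using e(1) unfolding E_def by blast
      then show False using E[of d False] e(2) by simp
    qed
    then show ?thesis by blast
  qed
  ultimately have "two_factorization (contract G F) (E True) (E False)"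
    using two by (simp add: two_factorization_def)
  moreover have "traversing G e t \<longleftrightarrow> color_switching (contract G F) (E True) (E False) t"
    if eF: "e \<in> verts (contract G F)" and t: "transition_at (contract G F) e t" for e t
  proof -
    obtain u v where uv: "u \<in> verts G" "v \<in> verts G" "c u \<noteq> c v"
      "{d \<in> ends G. edge_of G d = e} = {fend u, fend v}"
      "\<forall>w\<in>verts G. fedge w = e \<longleftrightarrow> w = u \<or> w = v"
      using ends_of[of e] eF unfolding contract_simps by blast
    obtain d d' where d: "t = {d, d'}" "d \<in> ends G" "d' \<in> ends G" "edge_of G d \<notin> F"
      "edge_of G d' \<notin> F" "fedge (vert_of G d) = e" "fedge (vert_of G d') = e"
      using t unfolding transition_at_def contract_simps by (auto simp: vert_of_contract)
    have at: "vert_of G d = u \<or> vert_of G d = v" "vert_of G d' = u \<or> vert_of G d' = v"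
      using d(6,7) bspec[OF uv(5) vert_in[OF d(2)]] bspec[OF uv(5) vert_in[OF d(3)]] by auto
    have "non_traversing G e t \<longleftrightarrow> (\<exists>a\<in>{fend u, fend v}. \<forall>d\<in>t. vert_of G d = vert_of G a)"
      unfolding non_traversing_def uv(4)[symmetric] by blast
    also have "\<dots> \<longleftrightarrow> vert_of G d = vert_of G d'"
      using at fend(3)[OF uv(1)] fend(3)[OF uv(2)] by (auto simp: d(1))
    \<comment> \<open>Both edge-ends lie at \<open>u\<close> or \<open>v\<close>, and the color
      distinguishes these two vertices.\<close>
    also have "\<dots> \<longleftrightarrow> c (vert_of G d) = c (vert_of G d')"
      using at uv(3) by metis
    also have "\<dots> \<longleftrightarrow> \<not> color_switching (contract G F) (E True) (E False) t"
      unfolding color_switching_def d(1) contract_simps by (auto simp: E[OF d(2,4)] E[OF d(3,5)])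
    finally show ?thesis by (simp add: traversing_def)
  qed
  ultimately show ?thesis by (intro exI conjI ballI allI impI)
qed

end

text \<open>Walks inside a cycle of \<open>Y\<close> use only edges outside \<open>F\<close>, so the
  coloring is constant on every cycle and induces the bipartition; edges of \<open>F\<close> cross
  it because they switch colors.\<close>

lemma special_of_coloring:
  assumes F: "one_factor G F" and c: "switching_coloring G F c"
  shows "special_one_factor G F"
proof -
  define Y where "Y = spanning G (edges G - F)"
  have const: "c u = c v" if "C \<in> cycles Y" "u \<in> verts C" "v \<in> verts C" for C u v
  proof -
    have C: "C = restrict_to Y (verts C) (edges C)" and con: "(adjacent C)\<^sup>*\<^sup>* u v"
      using that by (auto simp: cycles_def subgraph_def connected_def)
    \<comment> \<open>The equation in \<open>subgraph\<close> transfers the incidence data from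
      \<open>Y\<close>, so that adjacency in \<open>C\<close> implies adjacency in
      \<open>Y\<close>.\<close>
    have sub: "vert_of C = vert_of Y" "edge_of C = edge_of Y"
      "ends C = {d \<in> ends Y. edge_of Y d \<in> edges C}"
      by (metis C restrict_to_simps(3-5))+
    have "c x = c y" if adj: "adjacent C x y" for x y
    proof -
      have "adjacent Y x y"
        using adj unfolding adjacent_def sub by blast
      then obtain d d' where "d \<in> ends G" "d' \<in> ends G" "edge_of G d \<notin> F"
        "edge_of G d = edge_of G d'" "vert_of G d = x" "vert_of G d' = y"
        by (auto simp: adjacent_def Y_def)
      then show ?thesis using switching_coloringD(1)[OF c, of d d'] by simp
    qed
    with con show ?thesis by (induction rule: rtranclp_induct) auto
  qed
  define P where "P = {C \<in> cycles Y. \<forall>v\<in>verts C. c v}"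
  \<comment> \<open>By constancy a single vertex decides the side of its cycle.\<close>
  have P: "C \<in> P \<longleftrightarrow> c v" if "C \<in> cycles Y" "v \<in> verts C" for C v
    unfolding P_def using const[OF that(1) that(2)] that by blast
  have "bipartite (cycle_graph G F)"
    unfolding bipartite_def
  proof (intro exI conjI)
    show "P \<union> (cycles Y - P) = fst (cycle_graph G F)" "P \<inter> (cycles Y - P) = {}"
      by (auto simp: cycle_graph_def Let_def Y_def[symmetric] P_def)
    have "x \<in> P \<and> y \<in> cycles Y - P \<or> x \<in> cycles Y - P \<and> y \<in> P"
      if adj: "(x, y) \<in> snd (cycle_graph G F)" for x y
    proof -
      obtain d d' where xy: "x \<in> cycles Y" "y \<in> cycles Y" and
        d: "d \<in> ends G" "d' \<in> ends G" "d \<noteq> d'" "edge_of G d \<in> F" "edge_of G d' = edge_of G d"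
        and "vert_of G d \<in> verts x" "vert_of G d' \<in> verts y"
        using adj unfolding cycle_graph_def Let_def Y_def[symmetric] by auto
      then show ?thesis
        using P[of x "vert_of G d"] P[of y "vert_of G d'"] switching_coloringD(2)[OF c, of d d'] by auto
    qed
    then show "\<forall>(x, y)\<in>snd (cycle_graph G F).
        x \<in> P \<and> y \<in> cycles Y - P \<or> x \<in> cycles Y - P \<and> y \<in> P"
      by blast
  qed
  with F show ?thesis by (simp add: special_one_factor_def)
qed

section \<open>Splitting a 2-factorized quartic graph\<close>

lemma UNIV_color: "(UNIV :: color set) = {Blue, Red}"
  using color.exhaust by blast

lemma not_Blue_iff: "c \<noteq> Blue \<longleftrightarrow> c = Red"
  by (cases c) simp_all

lemma color_split_simps [simp]:
  "verts (color_split X B) = verts X \<times> UNIV"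
  "edges (color_split X B) = Inl ` edges X \<union> Inr ` verts X"
  "ends (color_split X B) = Inl ` ends X \<union> Inr ` (verts X \<times> UNIV)"
  "vert_of (color_split X B) (Inl d) = (vert_of X d, if edge_of X d \<in> B then Blue else Red)"
  "vert_of (color_split X B) (Inr p) = p"
  "edge_of (color_split X B) (Inl d) = Inl (edge_of X d)"
  "edge_of (color_split X B) (Inr p) = Inr (fst p)"
  by (simp_all add: color_split_def)

locale factorized_quartic =
  fixes X :: "('x, 'y, 'z) mgraph" and B R :: "'y set"
  assumes quartic: "quartic X" and factorization: "two_factorization X B R"
begin

abbreviation "S \<equiv> color_split X B"
abbreviation "FS \<equiv> Inr ` verts X :: ('y + 'x) set"

text \<open>The same conditional as in \<open>color_split\<close>: the second component of the
  vertex to which \<open>Inl d\<close> is attached in \<open>S\<close>.\<close>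

definition hue :: "'z \<Rightarrow> color" where
  "hue d = (if edge_of X d \<in> B then Blue else Red)"

lemma multigraph: "multigraph X"
  using quartic by (simp add: quartic_def)

lemma vert_in: "d \<in> ends X \<Longrightarrow> vert_of X d \<in> verts X"
  using multigraph by (auto simp: multigraph_def)

lemma edge_in: "d \<in> ends X \<Longrightarrow> edge_of X d \<in> edges X"
  using multigraph by (auto simp: multigraph_def)

lemma not_B_iff: "d \<in> ends X \<Longrightarrow> edge_of X d \<notin> B \<longleftrightarrow> edge_of X d \<in> R"
  using factorization edge_in by (auto simp: two_factorization_def)

text \<open>Both factors are 2-regular at \<open>x\<close>; \<open>not_B_iff\<close> turns the hue
  \<open>Red\<close> into membership in \<open>R\<close>, so one statement covers both
  colors.\<close>

lemma card_hue:
  assumes "x \<in> verts X"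
  shows "card {d \<in> ends X. vert_of X d = x \<and> hue d = c} = 2"
proof -
  have "{d \<in> ends X. vert_of X d = x \<and> hue d = c} =
      {d \<in> ends X. edge_of X d \<in> (case c of Blue \<Rightarrow> B | Red \<Rightarrow> R) \<and> vert_of X d = x}"
    using not_B_iff by (cases c) (auto simp: hue_def)
  moreover have "card {d \<in> ends X. edge_of X d \<in> (case c of Blue \<Rightarrow> B | Red \<Rightarrow> R) \<and> vert_of X d = x} = 2"
    using factorization assms
    by (cases c) (auto simp: two_factorization_def two_factor_def regular_def degree_def conj_assoc)
  ultimately show ?thesis by simp
qed

text \<open>Both colors occur at every vertex. Uniqueness relies on this to prevent one color from
  occupying both halves of a split vertex.\<close>

lemma ex_hue:
  assumes "x \<in> verts X"
  shows "\<exists>d\<in>ends X. vert_of X d = x \<and> hue d = c"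
proof -
  have "{d \<in> ends X. vert_of X d = x \<and> hue d = c} \<noteq> {}"
    using card_hue[OF assms, of c] by (metis card.empty zero_neq_numeral)
  then show ?thesis by blast
qed

text \<open>At \<open>(x, c)\<close> there are the two edge-ends at \<open>x\<close> of hue
  \<open>c\<close> and one end of the inserted edge.\<close>

lemma cubic_split: "cubic S"
proof -
  have "multigraph S"
    unfolding multigraph_def
  proof (intro conjI ballI)
    show "finite (verts S)" "finite (edges S)"
      using multigraph by (auto simp: multigraph_def UNIV_color)
    show "vert_of S ` ends S \<subseteq> verts S" using vert_in by auto
    show "edge_of S ` ends S \<subseteq> edges S" using edge_in by auto
    fix e assume "e \<in> edges S"
    then consider (old) y where "e = Inl y" "y \<in> edges X" | (new) x where "e = Inr x" "x \<in> verts X"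
      by auto
    then show "card {d \<in> ends S. edge_of S d = e} = 2"
    proof cases
      case old
      then have "{d \<in> ends S. edge_of S d = e} = Inl ` {d \<in> ends X. edge_of X d = y}"
        by auto
      then show ?thesis
        using old multigraph by (simp add: card_image multigraph_def)
    next
      case new
      then have "{d \<in> ends S. edge_of S d = e} = Inr ` ({x} \<times> UNIV)"
        by auto
      then show ?thesis by (simp add: card_image UNIV_color)
    qed
  qed
  moreover have "regular 3 S"
    unfolding regular_def degree_def
  proof
    fix p assume "p \<in> verts S"
    then obtain x c where p: "p = (x, c)" "x \<in> verts X" by auto
    have "{d \<in> ends S. vert_of S d = p} =
        insert (Inr p) (Inl ` {d \<in> ends X. vert_of X d = x \<and> hue d = c})"
      using p by (auto simp: hue_def)
    moreover have "card (insert (Inr p) (Inl ` {d \<in> ends X. vert_of X d = x \<and> hue d = c})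
        :: ('z + 'x \<times> color) set) = 3"
      using card_hue[OF p(2), of c]
      by (subst card_insert_disjoint) (auto simp: card_image intro: card_ge_0_finite)
    ultimately show "card {d \<in> ends S. vert_of S d = p} = 3" by simp
  qed
  ultimately show ?thesis by (simp add: cubic_def)
qed

lemma one_factor_split: "one_factor S FS"
  unfolding one_factor_def regular_def degree_def
proof (intro conjI ballI)
  fix p assume "p \<in> verts (spanning S FS)"
  then have "{d \<in> ends (spanning S FS). vert_of (spanning S FS) d = p} = {Inr p}"
    by auto
  then show "card {d \<in> ends (spanning S FS). vert_of (spanning S FS) d = p} = 1" by simp
qed simp

lemma special_split: "special_one_factor S FS"
proof (rule special_of_coloring[OF one_factor_split])
  \<comment> \<open>Old edges have both ends at vertices carrying the color of the edge, whereas an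
    inserted edge joins the \<open>Blue\<close> and the \<open>Red\<close> copy of a vertex.\<close>
  show "switching_coloring S FS (\<lambda>p. snd p = Blue)"
    unfolding switching_coloring_def by (auto simp: not_Blue_iff)
qed

lemma iso_contract_split: "mgraph_iso X (contract S FS) Inr Inl Inl"
proof -
  interpret split: cubic_one_factor S FS
    using cubic_split one_factor_split by unfold_locales
  have "vert_of (contract S FS) (Inl d) = Inr (vert_of X d)" if d: "d \<in> ends X" for d
  proof -
    \<comment> \<open>As \<open>vert_of S (Inr p)\<close> is \<open>p\<close>, writing the vertex
      this way lets \<open>fend_vert_of\<close> identify its inserted end as
      \<open>Inr p\<close>.\<close>
    have "split.fend (vert_of S (Inr (vert_of S (Inl d)))) = Inr (vert_of S (Inl d))"
      using vert_in[OF d] by (intro split.fend_vert_of) auto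
    then show ?thesis using d by (simp add: split.vert_of_contract)
  qed
  then show ?thesis
    by (auto simp: mgraph_iso_def bij_betw_def)
qed

lemma special_color_splitting_split: "special_color_splitting X B R S FS Inr Inl Inl"
  using cubic_split special_split iso_contract_split not_B_iff
  by (auto simp: special_color_splitting_def split: if_splits)

end

section \<open>Uniqueness of the color-preserving splitting\<close>

text \<open>On edges and on old edge-ends the isomorphism is prescribed by \<psi>, \<phi> and
  \<eta>. The vertex map sends \<open>(x, c)\<close> to the vertex carrying the images of the
  edge-ends at \<open>x\<close> of hue \<open>c\<close>; the crux is that all of them share one
  vertex.\<close>

lemma splitting_unique:
  assumes "quartic X" "two_factorization X B R"
    and spl: "special_color_splitting X B R G F \<phi> \<psi> \<eta>"
  shows "\<exists>\<alpha> \<beta> \<gamma>. mgraph_iso (color_split X B) G \<alpha> \<beta> \<gamma> \<and>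
    (\<forall>x. \<beta> (Inr x) = \<phi> x) \<and> (\<forall>e. \<beta> (Inl e) = \<psi> e) \<and> (\<forall>d. \<gamma> (Inl d) = \<eta> d)"
proof -
  interpret factorized_quartic X B R using assms by unfold_locales
  interpret G: cubic_one_factor G F
    using spl by unfold_locales (auto simp: special_color_splitting_def special_one_factor_def)
  have iso: "bij_betw \<phi> (verts X) F" "bij_betw \<psi> (edges X) (edges G - F)"
    "bij_betw \<eta> (ends X) {d \<in> ends G. edge_of G d \<notin> F}"
    "\<And>d. d \<in> ends X \<Longrightarrow> vert_of (contract G F) (\<eta> d) = \<phi> (vert_of X d)"
    "\<And>d. d \<in> ends X \<Longrightarrow> edge_of G (\<eta> d) = \<psi> (edge_of X d)"
    using spl by (auto simp: special_color_splitting_def mgraph_iso_def)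
  have \<eta>: "\<eta> d \<in> ends G" "edge_of G (\<eta> d) \<notin> F" if "d \<in> ends X" for d
    using bij_betwE[OF iso(3)] that by auto
  have fedge: "G.fedge (vert_of G (\<eta> d)) = \<phi> (vert_of X d)" if "d \<in> ends X" for d
    using iso(4) G.vert_of_contract \<eta> that by metis
  have hue_eq: "hue d = hue d'"
    if "d \<in> ends X" "d' \<in> ends X" "vert_of G (\<eta> d) = vert_of G (\<eta> d')" for d d'
    using spl that not_B_iff unfolding special_color_splitting_def hue_def by metis
  \<comment> \<open>An arbitrary edge-end at \<open>x\<close> of the given hue, available by
    \<open>ex_hue\<close>; \<open>same\<close> shows that the choice does not affect
    \<open>\<alpha>\<close>.\<close>
  define rep where "rep p = (SOME d. d \<in> ends X \<and> vert_of X d = fst p \<and> hue d = snd p)" for p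
  define \<alpha> where "\<alpha> p = vert_of G (\<eta> (rep p))" for p
  have rep: "rep (x, c) \<in> ends X" "vert_of X (rep (x, c)) = x" "hue (rep (x, c)) = c"
    if "x \<in> verts X" for x c
    using someI_ex[of "\<lambda>d. d \<in> ends X \<and> vert_of X d = x \<and> hue d = c"] ex_hue[OF that, of c]
    by (auto simp: rep_def)
  \<comment> \<open>Pigeonhole: if \<open>d\<close> and \<open>d'\<close> went to different
    vertices, they would fill both ends of the edge inserted at their vertex. An edge-end
    \<open>d1\<close> of the other hue would then share a vertex with one of them, against
    \<open>hue_eq\<close>.\<close>
  have same: "vert_of G (\<eta> d) = vert_of G (\<eta> d')"
    if d: "d \<in> ends X" "d' \<in> ends X" "vert_of X d = vert_of X d'" "hue d = hue d'" for d d'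
  proof (rule ccontr)
    assume ne: "vert_of G (\<eta> d) \<noteq> vert_of G (\<eta> d')"
    obtain d1 where d1: "d1 \<in> ends X" "vert_of X d1 = vert_of X d" "hue d1 \<noteq> hue d"
      using ex_hue[OF vert_in[OF d(1)]] by (metis color.distinct(1))
    have "\<phi> (vert_of X d) \<in> F" using bij_betwE[OF iso(1)] vert_in[OF d(1)] by auto
    then obtain u v where uv: "\<forall>w\<in>verts G. G.fedge w = \<phi> (vert_of X d) \<longleftrightarrow> w = u \<or> w = v"
      by (rule G.F_edge_ends)
    have "vert_of G (\<eta> a) = u \<or> vert_of G (\<eta> a) = v" if "a \<in> {d, d', d1}" for a
      using that bspec[OF uv, of "vert_of G (\<eta> a)"] G.vert_in \<eta> fedge d d1 by auto
    then have "vert_of G (\<eta> d1) = vert_of G (\<eta> d) \<or> vert_of G (\<eta> d1) = vert_of G (\<eta> d')"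
      using ne by (metis insertCI)
    then show False using hue_eq d d1 by metis
  qed
  have \<alpha>: "\<alpha> (vert_of X d, hue d) = vert_of G (\<eta> d)" if "d \<in> ends X" for d
    using same that rep vert_in unfolding \<alpha>_def by metis
  have \<alpha>_in: "\<alpha> p \<in> verts G" and \<alpha>_fedge: "G.fedge (\<alpha> p) = \<phi> (fst p)"
    if "p \<in> verts X \<times> UNIV" for p
    using that rep[of "fst p" "snd p"] \<eta> G.vert_in fedge unfolding \<alpha>_def by auto
  have bij_\<alpha>: "bij_betw \<alpha> (verts X \<times> UNIV) (verts G)"
    unfolding bij_betw_def
  proof
    \<comment> \<open>The inserted edge at the image determines the first component, the hue of the
      attached edge-ends the second.\<close>
    show "inj_on \<alpha> (verts X \<times> UNIV)"
    proof (rule inj_onI)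
      fix p q assume pq: "p \<in> verts X \<times> UNIV" "q \<in> verts X \<times> UNIV" "\<alpha> p = \<alpha> q"
      then have "\<phi> (fst p) = \<phi> (fst q)" using \<alpha>_fedge by metis
      then have "fst p = fst q"
        using pq iso(1) by (auto simp: bij_betw_def dest: inj_onD)
      moreover have "snd p = snd q"
        using pq hue_eq[of "rep p" "rep q"] rep[of "fst p" "snd p"] rep[of "fst q" "snd q"]
        unfolding \<alpha>_def by auto
      ultimately show "p = q" by (simp add: prod_eq_iff)
    qed
    \<comment> \<open>Each vertex of \<open>G\<close> carries an edge-end outside \<open>F\<close>,
      which is the image under \<eta> of an edge-end of \<open>X\<close>.\<close>
    have "w \<in> \<alpha> ` (verts X \<times> UNIV)" if w: "w \<in> verts G" for w
    proof -
      have "{d \<in> ends G. edge_of G d \<notin> F \<and> vert_of G d = w} \<noteq> {}"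
        using G.card_non_F_ends[OF w] by (metis card.empty zero_neq_numeral)
      then obtain d where d: "d \<in> {d \<in> ends G. edge_of G d \<notin> F}" "vert_of G d = w" by blast
      then obtain a where a: "a \<in> ends X" "d = \<eta> a"
        unfolding bij_betw_imp_surj_on[OF iso(3), symmetric] by (elim imageE)
      have "w = \<alpha> (vert_of X a, hue a)"
        using \<alpha>[OF a(1)] a(2) d(2) by simp
      then show ?thesis
        using vert_in[OF a(1)] by (intro image_eqI) auto
    qed
    then show "\<alpha> ` (verts X \<times> UNIV) = verts G" using \<alpha>_in by blast
  qed
  define \<beta> where "\<beta> = case_sum \<psi> \<phi>"
  \<comment> \<open>An inserted end at \<open>p\<close> must go to the end of \<open>F\<close> at
    the image vertex, which is \<open>G.fend (\<alpha> p)\<close>.\<close>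
  define \<gamma> where "\<gamma> = case_sum \<eta> (G.fend \<circ> \<alpha>)"
  have bij_fend: "bij_betw G.fend (verts G) {d \<in> ends G. edge_of G d \<in> F}"
    by (rule bij_betw_byWitness[where f' = "vert_of G"])
      (auto simp: G.fend G.fend_vert_of G.vert_in)
  have bij_sum: "bij_betw (case_sum f g) (Inl ` A \<union> Inr ` A') (T \<union> T')"
    if "bij_betw f A T" "bij_betw g A' T'" "T \<inter> T' = {}" for f g A A' T T'
  proof (rule bij_betw_combine)
    show "bij_betw (case_sum f g) (Inl ` A) T" "bij_betw (case_sum f g) (Inr ` A') T'"
      using that by (auto simp: bij_betw_def inj_on_def image_image)
  qed (rule that)
  have "bij_betw \<beta> (edges S) (edges G)"
    using bij_sum[OF iso(2,1)] G.F_subset by (auto simp: \<beta>_def Un_absorb2)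
  moreover have "bij_betw \<gamma> (ends S) (ends G)"
  proof -
    have "{d \<in> ends G. edge_of G d \<notin> F} \<union> {d \<in> ends G. edge_of G d \<in> F} = ends G" by blast
    then show ?thesis
      using bij_sum[OF iso(3) bij_betw_trans[OF bij_\<alpha> bij_fend]] unfolding \<gamma>_def by auto
  qed
  moreover have "vert_of G (\<gamma> d) = \<alpha> (vert_of S d) \<and> edge_of G (\<gamma> d) = \<beta> (edge_of S d)"
    if "d \<in> ends S" for d
  proof (cases d)
    case (Inl a)
    with that show ?thesis
      using \<alpha>[of a] iso(5) by (auto simp: \<gamma>_def \<beta>_def hue_def)
  next
    case (Inr p)
    with that have "p \<in> verts X \<times> UNIV" by auto
    with Inr show ?thesis
      using \<alpha>_in \<alpha>_fedge G.fend(3) by (simp add: \<gamma>_def \<beta>_def)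
  qed
  ultimately have "mgraph_iso S G \<alpha> \<beta> \<gamma>"
    using bij_\<alpha> by (simp add: mgraph_iso_def)
  then show ?thesis
    by (intro exI[of _ \<alpha>] exI[of _ \<beta>] exI[of _ \<gamma>]) (simp add: \<beta>_def \<gamma>_def)
qed

text \<open>Uniqueness takes the form of an isomorphism extending the given identification of
  \<open>X\<close> with the contraction, and carrying the inserted 1-factor to
  \<open>F'\<close>.\<close>

theorem theorem9:
  "(\<forall>(G :: ('v, 'e, 'd) mgraph) F.
      cubic G \<and> special_one_factor G F \<longrightarrow>
      quartic (contract G F) \<and>
      (\<exists>B R. two_factorization (contract G F) B R \<and>
        (\<forall>e\<in>verts (contract G F). \<forall>t. transition_at (contract G F) e t \<longrightarrow>
           (traversing G e t \<longleftrightarrow> color_switching (contract G F) B R t)))) \<and>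
   (\<forall>(X :: ('x, 'y, 'z) mgraph) B R.
      quartic X \<and> two_factorization X B R \<longrightarrow>
      cubic (color_split X B) \<and>
      special_one_factor (color_split X B) (Inr ` verts X) \<and>
      mgraph_iso X (contract (color_split X B) (Inr ` verts X)) Inr Inl Inl \<and>
      special_color_splitting X B R (color_split X B) (Inr ` verts X) Inr Inl Inl \<and>
      (\<forall>(G' :: ('w, 'f, 'c) mgraph) F' \<phi> \<psi> \<eta>.
         special_color_splitting X B R G' F' \<phi> \<psi> \<eta> \<longrightarrow>
         (\<exists>\<alpha> \<beta> \<gamma>. mgraph_iso (color_split X B) G' \<alpha> \<beta> \<gamma> \<and>
            \<beta> ` (Inr ` verts X) = F' \<and>
            (\<forall>x\<in>verts X. \<beta> (Inr x) = \<phi> x) \<and>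
            (\<forall>e\<in>edges X. \<beta> (Inl e) = \<psi> e) \<and>
            (\<forall>d\<in>ends X. \<gamma> (Inl d) = \<eta> d))))"
proof (intro conjI allI impI; (elim conjE)?)
  fix G :: "('v, 'e, 'd) mgraph" and F
  assume G: "cubic G" "special_one_factor G F"
  then interpret cubic_one_factor G F
    by unfold_locales (auto simp: special_one_factor_def)
  show "quartic (contract G F)" by (rule quartic_contract)
  show "\<exists>B R. two_factorization (contract G F) B R \<and>
        (\<forall>e\<in>verts (contract G F). \<forall>t. transition_at (contract G F) e t \<longrightarrow>
           (traversing G e t \<longleftrightarrow> color_switching (contract G F) B R t))"
    using special_imp_coloring[OF G(2)] two_factorization_of_coloring by blast
next
  fix X :: "('x, 'y, 'z) mgraph" and B R
  assume X: "quartic X" "two_factorization X B R"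
  then interpret factorized_quartic X B R by unfold_locales
  show "cubic S" "special_one_factor S FS" "mgraph_iso X (contract S FS) Inr Inl Inl"
    "special_color_splitting X B R S FS Inr Inl Inl"
    by (rule cubic_split special_split iso_contract_split special_color_splitting_split)+
  fix G' :: "('w, 'f, 'c) mgraph" and F' \<phi> \<psi> \<eta>
  assume spl: "special_color_splitting X B R G' F' \<phi> \<psi> \<eta>"
  \<comment> \<open>The vertices of the contraction are the edges of \<open>F'\<close>, so the
    vertex part of the identification maps onto \<open>F'\<close>.\<close>
  then have "\<phi> ` verts X = F'"
    by (auto simp: special_color_splitting_def mgraph_iso_def bij_betw_def contract_def)
  moreover obtain \<alpha> \<beta> \<gamma> where "mgraph_iso S G' \<alpha> \<beta> \<gamma>"
    "\<forall>x. \<beta> (Inr x) = \<phi> x" "\<forall>e. \<beta> (Inl e) = \<psi> e" "\<forall>d. \<gamma> (Inl d) = \<eta> d"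
    using splitting_unique[OF X spl] by blast
  ultimately show "\<exists>\<alpha> \<beta> \<gamma>. mgraph_iso S G' \<alpha> \<beta> \<gamma> \<and> \<beta> ` FS = F' \<and>
      (\<forall>x\<in>verts X. \<beta> (Inr x) = \<phi> x) \<and> (\<forall>e\<in>edges X. \<beta> (Inl e) = \<psi> e) \<and>
      (\<forall>d\<in>ends X. \<gamma> (Inl d) = \<eta> d)"
    by (intro exI[of _ \<alpha>] exI[of _ \<beta>] exI[of _ \<gamma>]) (simp add: image_image)
qed

end
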